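(* Let $G$ be a finitely generated infinite amenable group. Then $\dim_{\mathbb{R}} H_0^{\mathrm{uf}}(G;\mathbb{R})/\widehat{H}_0^{\mathrm{uf}}(G;\mathbb{R})=\infty$, where $\widehat{H}_0^{\mathrm{uf}}(G;\mathbb{R})$ is the mean-invisible part of $H_0^{\mathrm{uf}}(G;\mathbb{R})$. In particular, $\dim_{\mathbb{R}} H_0^{\mathrm{uf}}(G;\mathbb{R})=\infty$.
   Context: Groups are discrete. $\ell^\infty(G)$ is the space of bounded functions $G\to\mathbb{R}$ with left action $(g\cdot\varphi)(g')=\varphi(g^{-1}g')$. $M(G)$ is the set of left $G$-invariant means, i.e. linear maps $m\colon\ell^\infty(G)\to\mathbb{R}$ with $m(\chi_G)=1$, with $m(\varphi)\ge 0$ whenever $\varphi\geq 0$, and with $m(g\cdot\varphi)=m(\varphi)$ for all $g\in G$, $\varphi\in\ell^\infty(G)$. $G$ is amenable if $M(G)\neq\emptyset$. Uniformly finite homology. Equip the finitely generated group $G$ with the word metric $d(g,h)=\min\{k: g^{-1}h=s_1\cdots s_k,\ s_i\in S\cup S^{-1}\}$ for a finite generating set $S$. $C_n^{\mathrm{uf}}(G;\mathbb{R})$ is the real vector space of bounded functions $c\colon G^{n+1}\to\mathbb{R}$ for which there is $R_c>0$ such that $c(x_0,\dots,x_n)=0$ whenever $\sup_{i,j}d(x_i,x_j)>R_c$. Writing $c$ as a formal sum $\sum_x c(x)\cdot x$, the boundary operator is given by $\partial_n(x_0,\dots,x_n)=\sum_{j=0}^n(-1)^j(x_0,\dots,\widehat{x_j},\dots,x_n)$,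 extended to (infinite) formal sums. $H_*^{\mathrm{uf}}(G;\mathbb{R})$ is the homology of this complex; it does not depend on $S$ up to canonical isomorphism. In particular $C_0^{\mathrm{uf}}(G;\mathbb{R})=\ell^\infty(G)$. For $m\in M(G)$ let $\overline{m}_0\colon C_0^{\mathrm{uf}}(G;\mathbb{R})\to\mathbb{R}$ be $\overline{m}_0(c)=m(g\mapsto c(g^{-1}))$; this is a right-invariant mean and induces a well-defined linear map $\overline{m}_0\colon H_0^{\mathrm{uf}}(G;\mathbb{R})\to\mathbb{R}$. The mean-invisible part is the subspace $\widehat{H}_0^{\mathrm{uf}}(G;\mathbb{R})=\{c\in H_0^{\mathrm{uf}}(G;\mathbb{R}) : \overline{m}_0(c)=0\text{ for all } m\in M(G)\}$. *)

theory Defs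
  imports "HOL-Analysis.Elementary_Metric_Spaces" "HOL-Algebra.Generated_Groups" "HOL-Algebra.AbelCoset"
    "Jordan_Normal_Form.VS_Connect"
begin

section \<open>Quotient vector spaces\<close>

text \<open>The fields \<open>mult\<close> and \<open>one\<close> belong to the underlying ring record and play no role for
  vector spaces.  In the scalar multiplication, adding \<open>W\<close> makes the result a coset also for
  \<open>a = 0\<close>.\<close>

definition quot_module ::
    "('r, 'v, 'k) module_scheme \<Rightarrow> 'v set \<Rightarrow> ('r, 'v set) module" where
  "quot_module V W =
    \<lparr>carrier = A_RCOSETS V W, monoid.mult = undefined, one = undefined,
     zero = W, add = set_add V,
     smult = (\<lambda>a X. set_add V W ((\<lambda>v. a \<odot>\<^bsub>V\<^esub> v) ` X))\<rparr>"


section \<open>Invariant means\<close>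

text \<open>Functions on a group, or on tuples of group elements, are represented by total functions
  that vanish outside their intended domain, so that equality and the vector space
  operations are the pointwise ones.\<close>

definition linf :: "('a, 'b) monoid_scheme \<Rightarrow> ('a \<Rightarrow> real) set" where
  "linf G = {\<phi>. bounded (range \<phi>) \<and> (\<forall>x. x \<notin> carrier G \<longrightarrow> \<phi> x = 0)}"

definition left_translate ::
    "('a, 'b) monoid_scheme \<Rightarrow> 'a \<Rightarrow> ('a \<Rightarrow> real) \<Rightarrow> 'a \<Rightarrow> real" where
  "left_translate G g \<phi> = (\<lambda>x. if x \<in> carrier G then \<phi> (inv\<^bsub>G\<^esub> g \<otimes>\<^bsub>G\<^esub> x) else 0)"

text \<open>The values of a mean outside \<^const>\<open>linf\<close> are irrelevant and left unconstrained.\<close>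

definition invariant_means :: "('a, 'b) monoid_scheme \<Rightarrow> (('a \<Rightarrow> real) \<Rightarrow> real) set" where
  "invariant_means G = {m.
     (\<forall>\<phi>\<in>linf G. \<forall>\<psi>\<in>linf G. m (\<lambda>x. \<phi> x + \<psi> x) = m \<phi> + m \<psi>) \<and>
     (\<forall>a. \<forall>\<phi>\<in>linf G. m (\<lambda>x. a * \<phi> x) = a * m \<phi>) \<and>
     m (indicator (carrier G)) = 1 \<and>
     (\<forall>\<phi>\<in>linf G. (\<forall>x\<in>carrier G. 0 \<le> \<phi> x) \<longrightarrow> 0 \<le> m \<phi>) \<and>
     (\<forall>g\<in>carrier G. \<forall>\<phi>\<in>linf G. m (left_translate G g \<phi>) = m \<phi>)}"

definition amenable :: "('a, 'b) monoid_scheme \<Rightarrow> bool" where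
  "amenable G \<longleftrightarrow> invariant_means G \<noteq> {}"


section \<open>Uniformly finite homology\<close>

definition word_dist :: "('a, 'b) monoid_scheme \<Rightarrow> 'a set \<Rightarrow> 'a \<Rightarrow> 'a \<Rightarrow> nat" where
  "word_dist G S g h = (LEAST k. \<exists>w. length w = k \<and> set w \<subseteq> S \<union> m_inv G ` S \<and>
     foldr (\<otimes>\<^bsub>G\<^esub>) w \<one>\<^bsub>G\<^esub> = inv\<^bsub>G\<^esub> g \<otimes>\<^bsub>G\<^esub> h)"

text \<open>An \<open>(n+1)\<close>-tuple \<open>(x\<^sub>0, \<dots>, x\<^sub>n)\<close> is a list of length \<open>n + 1\<close>.\<close>

definition tuples :: "('a, 'b) monoid_scheme \<Rightarrow> nat \<Rightarrow> 'a list set" where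
  "tuples G n = {x. length x = Suc n \<and> set x \<subseteq> carrier G}"

definition tuple_diam :: "('a, 'b) monoid_scheme \<Rightarrow> 'a set \<Rightarrow> 'a list \<Rightarrow> nat" where
  "tuple_diam G S x =
     Max {word_dist G S (x ! i) (x ! j) | i j. i < length x \<and> j < length x}"

definition uf_chains ::
    "('a, 'b) monoid_scheme \<Rightarrow> 'a set \<Rightarrow> nat \<Rightarrow> (real, 'a list \<Rightarrow> real) module" where
  "uf_chains G S n =
    \<lparr>carrier = {c. bounded (range c) \<and> (\<forall>x. x \<notin> tuples G n \<longrightarrow> c x = 0) \<and>
       (\<exists>R>0. \<forall>x\<in>tuples G n. real (tuple_diam G S x) > R \<longrightarrow> c x = 0)},
     monoid.mult = undefined, one = undefined,
     zero = (\<lambda>x. 0), add = (\<lambda>c d x. c x + d x), smult = (\<lambda>a c x. a * c x)\<rparr>"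

definition face :: "nat \<Rightarrow> 'a list \<Rightarrow> 'a list" where
  "face j x = take j x @ drop (Suc j) x"

text \<open>The coefficient of \<open>y\<close> in \<open>\<partial>\<^sub>n (\<Sum>\<^sub>x c(x) x)\<close>.  For a uniformly finite chain \<open>c\<close> and a
  finite generating set, only finitely many \<open>x\<close> in the support of \<open>c\<close> have \<open>y\<close> as their
  \<open>j\<close>-th face, so the inner sum is finite.  The complex is not augmented:
  \<open>\<partial>\<^sub>0 = 0\<close>.\<close>

definition uf_boundary :: "nat \<Rightarrow> ('a list \<Rightarrow> real) \<Rightarrow> 'a list \<Rightarrow> real" where
  "uf_boundary n c = (\<lambda>y. if n = 0 then 0
     else (\<Sum>j\<le>n. (-1) ^ j * (\<Sum>x | c x \<noteq> 0 \<and> face j x = y. c x)))"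

definition uf_cycles :: "('a, 'b) monoid_scheme \<Rightarrow> 'a set \<Rightarrow> nat \<Rightarrow> ('a list \<Rightarrow> real) set" where
  "uf_cycles G S n = {c \<in> carrier (uf_chains G S n). uf_boundary n c = (\<lambda>y. 0)}"

definition uf_boundaries ::
    "('a, 'b) monoid_scheme \<Rightarrow> 'a set \<Rightarrow> nat \<Rightarrow> ('a list \<Rightarrow> real) set" where
  "uf_boundaries G S n = uf_boundary (Suc n) ` carrier (uf_chains G S (Suc n))"

definition uf_homology ::
    "('a, 'b) monoid_scheme \<Rightarrow> 'a set \<Rightarrow> nat \<Rightarrow> (real, ('a list \<Rightarrow> real) set) module" where
  "uf_homology G S n =
     quot_module (uf_chains G S n\<lparr>carrier := uf_cycles G S n\<rparr>) (uf_boundaries G S n)"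


section \<open>The mean-invisible part\<close>

definition mean_chain ::
    "('a, 'b) monoid_scheme \<Rightarrow> (('a \<Rightarrow> real) \<Rightarrow> real) \<Rightarrow> ('a list \<Rightarrow> real) \<Rightarrow> real" where
  "mean_chain G m c = m (\<lambda>g. if g \<in> carrier G then c [inv\<^bsub>G\<^esub> g] else 0)"

text \<open>The induced map on homology classes: the common value of \<^const>\<open>mean_chain\<close> on all
  representatives of the class.\<close>

definition mean_class ::
    "('a, 'b) monoid_scheme \<Rightarrow> (('a \<Rightarrow> real) \<Rightarrow> real) \<Rightarrow> ('a list \<Rightarrow> real) set \<Rightarrow> real" where
  "mean_class G m X = the_elem (mean_chain G m ` X)"

definition mean_invisible ::
    "('a, 'b) monoid_scheme \<Rightarrow> 'a set \<Rightarrow> ('a list \<Rightarrow> real) set set" where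
  "mean_invisible G S =
     {X \<in> carrier (uf_homology G S 0). \<forall>m\<in>invariant_means G. mean_class G m X = 0}"


section \<open>Well-definedness\<close>

text \<open>For a finitely generated group, degree-\<open>0\<close> homology is a real vector space, every
  left-invariant mean descends to it, and the mean-invisible part is a subspace.\<close>

lemma carrier_quot_module: "X \<in> carrier (quot_module V W) \<longleftrightarrow> (\<exists>v\<in>carrier V. X = W +>\<^bsub>V\<^esub> v)"
  by (auto simp: quot_module_def A_RCOSETS_def')

context
  fixes K :: "('r, 'c) ring_scheme" and V :: "('r, 'v, 'k) module_scheme" and W :: "'v set"
  assumes sub: "VectorSpace.subspace K W V"
begin

interpretation vectorspace K V using sub by (simp add: VectorSpace.subspace_def)

lemma subspace_submodule: "LinearCombinations.submodule K W V"
  using sub by (simp add: VectorSpace.subspace_def)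

interpretation W: LinearCombinations.submodule K W V by (rule subspace_submodule)

lemma subspace_abelian_subgroup: "abelian_subgroup W V"
proof -
  have minus: "a_inv V w \<in> W" if "w \<in> W" for w
    using W.smult_closed[OF _ that, of "\<ominus>\<^bsub>K\<^esub> \<one>\<^bsub>K\<^esub>"] W.subset that
    by (metis R.add.inv_closed R.one_closed smult_l_minus smult_one subsetD)
  have "additive_subgroup W V"
    by (intro additive_subgroupI subgroup.intro)
       (use W.subset minus in \<open>auto simp: a_inv_def[symmetric]\<close>)
  then show ?thesis
    by (rule abelian_subgroupI3) unfold_locales
qed

interpretation W: abelian_subgroup W V by (rule subspace_abelian_subgroup)

lemma quot_module_add: "(W +>\<^bsub>V\<^esub> v) \<oplus>\<^bsub>quot_module V W\<^esub> (W +>\<^bsub>V\<^esub> w) = W +>\<^bsub>V\<^esub> (v \<oplus>\<^bsub>V\<^esub> w)"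
  if that: "v \<in> carrier V" "w \<in> carrier V"
  using W.a_rcos_sum[OF that] by (simp add: quot_module_def)

lemma quot_module_zero: "\<zero>\<^bsub>quot_module V W\<^esub> = W +>\<^bsub>V\<^esub> \<zero>\<^bsub>V\<^esub>"
  using W.subset by (simp add: quot_module_def)

lemma quot_module_smult: "a \<odot>\<^bsub>quot_module V W\<^esub> (W +>\<^bsub>V\<^esub> v) = W +>\<^bsub>V\<^esub> (a \<odot>\<^bsub>V\<^esub> v)"
  if that: "a \<in> carrier K" "v \<in> carrier V"
proof -
  have "a \<odot>\<^bsub>quot_module V W\<^esub> (W +>\<^bsub>V\<^esub> v) = (\<Union>h\<in>W. \<Union>k\<in>W. {h \<oplus>\<^bsub>V\<^esub> a \<odot>\<^bsub>V\<^esub> (k \<oplus>\<^bsub>V\<^esub> v)})"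
    unfolding quot_module_def set_add_def' a_r_coset_def' by auto
  also have "\<dots> = (\<Union>h\<in>W. \<Union>k\<in>W. {(h \<oplus>\<^bsub>V\<^esub> a \<odot>\<^bsub>V\<^esub> k) \<oplus>\<^bsub>V\<^esub> a \<odot>\<^bsub>V\<^esub> v})"
    using W.subset that by (intro SUP_cong refl) (auto simp: smult_r_distr M.a_assoc subset_iff)
  also have "\<dots> = (\<Union>h\<in>W. {h \<oplus>\<^bsub>V\<^esub> a \<odot>\<^bsub>V\<^esub> v})"
  proof (intro equalityI UN_least subsetI)
    fix x h k assume hk: "h \<in> W" "k \<in> W" "x \<in> {(h \<oplus>\<^bsub>V\<^esub> a \<odot>\<^bsub>V\<^esub> k) \<oplus>\<^bsub>V\<^esub> a \<odot>\<^bsub>V\<^esub> v}"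
    have "h \<oplus>\<^bsub>V\<^esub> a \<odot>\<^bsub>V\<^esub> k \<in> W"
      by (rule W.m_closed[OF hk(1) W.smult_closed[OF that(1) hk(2)]])
    then show "x \<in> (\<Union>h\<in>W. {h \<oplus>\<^bsub>V\<^esub> a \<odot>\<^bsub>V\<^esub> v})" using hk(3) by (rule UN_I)
  next
    fix x h assume h: "h \<in> W" "x \<in> {h \<oplus>\<^bsub>V\<^esub> a \<odot>\<^bsub>V\<^esub> v}"
    have "h \<oplus>\<^bsub>V\<^esub> a \<odot>\<^bsub>V\<^esub> \<zero>\<^bsub>V\<^esub> = h" using h(1) that W.subset by (simp add: subset_iff)
    with h(2) have "x \<in> {(h \<oplus>\<^bsub>V\<^esub> a \<odot>\<^bsub>V\<^esub> \<zero>\<^bsub>V\<^esub>) \<oplus>\<^bsub>V\<^esub> a \<odot>\<^bsub>V\<^esub> v}" by simp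
    then show "x \<in> (\<Union>h\<in>W. \<Union>k\<in>W. {(h \<oplus>\<^bsub>V\<^esub> a \<odot>\<^bsub>V\<^esub> k) \<oplus>\<^bsub>V\<^esub> a \<odot>\<^bsub>V\<^esub> v})"
      by (intro UN_I[OF h(1)] UN_I[OF W.zero_closed])
  qed
  finally show ?thesis by (simp add: a_r_coset_def')
qed

lemma quot_module_vectorspace: "vectorspace K (quot_module V W)"
proof (rule vs_criteria)
  show "\<forall>v\<in>carrier (quot_module V W). \<exists>neg_v\<in>carrier (quot_module V W). v \<oplus>\<^bsub>quot_module V W\<^esub> neg_v = \<zero>\<^bsub>quot_module V W\<^esub>"
  proof
    fix X assume "X \<in> carrier (quot_module V W)"
    then obtain v where v: "v \<in> carrier V" "X = W +>\<^bsub>V\<^esub> v" unfolding carrier_quot_module ..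
    have "X \<oplus>\<^bsub>quot_module V W\<^esub> (W +>\<^bsub>V\<^esub> a_inv V v) = \<zero>\<^bsub>quot_module V W\<^esub>"
      unfolding v(2) quot_module_zero quot_module_add[OF v(1) M.a_inv_closed[OF v(1)]] M.r_neg[OF v(1)] ..
    moreover have "W +>\<^bsub>V\<^esub> a_inv V v \<in> carrier (quot_module V W)"
      unfolding carrier_quot_module using M.a_inv_closed[OF v(1)] by blast
    ultimately show "\<exists>Y\<in>carrier (quot_module V W). X \<oplus>\<^bsub>quot_module V W\<^esub> Y = \<zero>\<^bsub>quot_module V W\<^esub>" by blast
  qed
  show "field K" by (rule field_axioms)
  show "\<zero>\<^bsub>quot_module V W\<^esub> \<in> carrier (quot_module V W)" unfolding quot_module_zero carrier_quot_module by blast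
qed (clarsimp simp: carrier_quot_module, (auto simp: quot_module_add quot_module_smult quot_module_zero M.a_ac smult_r_distr smult_l_distr smult_assoc1)[])+

end

lemma uf_chains_sel [simp]:
  "add (uf_chains G S n) = (\<lambda>c d x. c x + d x)"
  "zero (uf_chains G S n) = (\<lambda>x. 0)"
  "module.smult (uf_chains G S n) = (\<lambda>a c x. a * c x)"
  by (simp_all add: uf_chains_def)

lemma uf_chains_vectorspace: "vectorspace class_ring (uf_chains G S n)"
proof (rule vs_criteria)
  have b: "bounded (range (\<lambda>x. a * c x))" if "bounded (range c)" for a and c :: "'a list \<Rightarrow> real"
  proof -
    from that obtain B where "\<And>x. \<bar>c x\<bar> \<le> B" by (auto simp: bounded_iff)
    then have "\<And>x. \<bar>a * c x\<bar> \<le> \<bar>a\<bar> * B" by (simp add: abs_mult mult_left_mono)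
    then show ?thesis by (auto simp: bounded_iff)
  qed
  have p: "bounded (range (\<lambda>x. c x + d x))" if "bounded (range c)" "bounded (range d)"
    for c d :: "'a list \<Rightarrow> real"
  proof -
    from that obtain B C where "\<And>x. \<bar>c x\<bar> \<le> B" "\<And>x. \<bar>d x\<bar> \<le> C" by (auto simp: bounded_iff)
    then have "\<And>x. \<bar>c x + d x\<bar> \<le> B + C" by (meson abs_triangle_ineq add_mono order_trans)
    then show ?thesis by (auto simp: bounded_iff)
  qed
  let ?C = "uf_chains G S n"
  show sm: "\<forall>a v. a \<in> carrier class_ring \<and> v \<in> carrier ?C \<longrightarrow> a \<odot>\<^bsub>?C\<^esub> v \<in> carrier ?C"
    by (auto simp: uf_chains_def b)
  show "\<forall>v\<in>carrier ?C. \<exists>w\<in>carrier ?C. v \<oplus>\<^bsub>?C\<^esub> w = \<zero>\<^bsub>?C\<^esub>"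
  proof
    fix v assume "v \<in> carrier ?C"
    then show "\<exists>w\<in>carrier ?C. v \<oplus>\<^bsub>?C\<^esub> w = \<zero>\<^bsub>?C\<^esub>"
      using sm[rule_format, of "-1" v] by (intro bexI[of _ "\<lambda>x. -1 * v x"]) auto
  qed
  show "\<forall>v w. v \<in> carrier ?C \<and> w \<in> carrier ?C \<longrightarrow> v \<oplus>\<^bsub>?C\<^esub> w \<in> carrier ?C"
  proof (intro allI impI)
    fix c d assume cd: "c \<in> carrier ?C \<and> d \<in> carrier ?C"
    then obtain R R' where "R>0" "\<forall>x\<in>tuples G n. real (tuple_diam G S x) > R \<longrightarrow> c x = 0"
      "\<forall>x\<in>tuples G n. real (tuple_diam G S x) > R' \<longrightarrow> d x = 0"
      by (auto simp: uf_chains_def)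
    then have "max R R' > 0 \<and> (\<forall>x\<in>tuples G n. real (tuple_diam G S x) > max R R' \<longrightarrow> c x + d x = 0)"
      by auto
    with cd show "c \<oplus>\<^bsub>?C\<^esub> d \<in> carrier ?C" by (force simp: uf_chains_def intro!: p)
  qed
qed (auto simp: algebra_simps class_field.field_axioms uf_chains_def intro: exI[of _ "1::real"])


lemma mean_scale: "m \<in> invariant_means G \<Longrightarrow> \<phi> \<in> linf G \<Longrightarrow> m (\<lambda>x. a * \<phi> x) = a * m \<phi>"
  by (simp add: invariant_means_def)
lemma mean_add: "m \<in> invariant_means G \<Longrightarrow> \<phi> \<in> linf G \<Longrightarrow> \<psi> \<in> linf G \<Longrightarrow> m (\<lambda>x. \<phi> x + \<psi> x) = m \<phi> + m \<psi>"
  by (simp add: invariant_means_def)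
lemma mean_trans: "m \<in> invariant_means G \<Longrightarrow> \<phi> \<in> linf G \<Longrightarrow> g \<in> carrier G \<Longrightarrow> m (left_translate G g \<phi>) = m \<phi>"
  by (simp add: invariant_means_def)

lemma mean_sum:
  assumes m: "m \<in> invariant_means G" and "finite T" and "\<And>t. t \<in> T \<Longrightarrow> f t \<in> linf G"
  shows "(\<lambda>x. \<Sum>t\<in>T. f t x) \<in> linf G \<and> m (\<lambda>x. \<Sum>t\<in>T. f t x) = (\<Sum>t\<in>T. m (f t))"
  using assms(2,3)
proof (induction T rule: finite_induct)
  case empty
  have "(\<lambda>x. 0) \<in> linf G" by (auto simp: linf_def bounded_iff)
  moreover from mean_scale[OF m this, of 0] have "m (\<lambda>x. 0) = 0" by simp
  ultimately show ?case by simp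
next
  case (insert t T)
  have p: "bounded (range (\<lambda>x. c x + d x))" if "bounded (range c)" "bounded (range d)"
    for c d :: "'a \<Rightarrow> real"
  proof -
    from that obtain B C where "\<And>x. \<bar>c x\<bar> \<le> B" "\<And>x. \<bar>d x\<bar> \<le> C" by (auto simp: bounded_iff)
    then have "\<And>x. \<bar>c x + d x\<bar> \<le> B + C" by (meson abs_triangle_ineq add_mono order_trans)
    then show ?thesis by (auto simp: bounded_iff)
  qed
  from insert have 1: "f t \<in> linf G" "(\<lambda>x. \<Sum>t\<in>T. f t x) \<in> linf G"
    "m (\<lambda>x. \<Sum>t\<in>T. f t x) = (\<Sum>t\<in>T. m (f t))" by auto
  then have "m (\<lambda>x. f t x + (\<Sum>t\<in>T. f t x)) = m (f t) + m (\<lambda>x. \<Sum>t\<in>T. f t x)"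
    by (intro mean_add[OF m])
  moreover have "(\<lambda>x. f t x + (\<Sum>t\<in>T. f t x)) \<in> linf G"
    using 1 by (auto simp: linf_def p)
  ultimately show ?case using insert 1 by simp
qed

definition wordball :: "('a, 'b) monoid_scheme \<Rightarrow> 'a set \<Rightarrow> nat \<Rightarrow> 'a set" where
  "wordball G S k = (\<lambda>w. foldr (\<otimes>\<^bsub>G\<^esub>) w \<one>\<^bsub>G\<^esub>) ` {w. set w \<subseteq> S \<union> m_inv G ` S \<and> length w \<le> k}"

context
  fixes G :: "('a, 'b) monoid_scheme" and S :: "'a set"
  assumes G: "group G" and S: "finite S" "S \<subseteq> carrier G" "generate G S = carrier G"
begin

interpretation group G by (rule G)

lemma foldr_mult_closed: "set w \<subseteq> carrier G \<Longrightarrow> foldr (\<otimes>\<^bsub>G\<^esub>) w \<one>\<^bsub>G\<^esub> \<in> carrier G"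
  by (induction w) auto

lemma foldr_mult_append: "set w \<subseteq> carrier G \<Longrightarrow> set v \<subseteq> carrier G \<Longrightarrow> 
   foldr (\<otimes>\<^bsub>G\<^esub>) (w @ v) \<one>\<^bsub>G\<^esub> = foldr (\<otimes>\<^bsub>G\<^esub>) w \<one>\<^bsub>G\<^esub> \<otimes>\<^bsub>G\<^esub> foldr (\<otimes>\<^bsub>G\<^esub>) v \<one>\<^bsub>G\<^esub>"
  by (induction w) (auto simp: m_assoc foldr_mult_closed)

lemma gens_closed: "S \<union> m_inv G ` S \<subseteq> carrier G" using S by auto

lemma ex_word:
  assumes "g \<in> carrier G"
  shows "\<exists>w. set w \<subseteq> S \<union> m_inv G ` S \<and> foldr (\<otimes>\<^bsub>G\<^esub>) w \<one>\<^bsub>G\<^esub> = g"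
proof -
  have "g \<in> generate G S" using assms S by simp
  then show ?thesis
  proof induction
    case one show ?case by (intro exI[of _ "[]"]) auto
  next
    case (incl h) then show ?case using S by (intro exI[of _ "[h]"]) auto
  next
    case (inv h) then show ?case using S by (intro exI[of _ "[inv\<^bsub>G\<^esub> h]"]) auto
  next
    case (eng h1 h2)
    then obtain w v where "set w \<subseteq> S \<union> m_inv G ` S" "foldr (\<otimes>\<^bsub>G\<^esub>) w \<one>\<^bsub>G\<^esub> = h1"
       "set v \<subseteq> S \<union> m_inv G ` S" "foldr (\<otimes>\<^bsub>G\<^esub>) v \<one>\<^bsub>G\<^esub> = h2" by auto
    moreover then have "foldr (\<otimes>\<^bsub>G\<^esub>) (w @ v) \<one>\<^bsub>G\<^esub> = h1 \<otimes>\<^bsub>G\<^esub> h2"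
      using foldr_mult_append[of w v] gens_closed by blast
    ultimately show ?case by (intro exI[of _ "w @ v"]) simp
  qed
qed

lemma dist_word:
  assumes "g \<in> carrier G" "h \<in> carrier G"
  shows "\<exists>w. length w = word_dist G S g h \<and> set w \<subseteq> S \<union> m_inv G ` S \<and>
     foldr (\<otimes>\<^bsub>G\<^esub>) w \<one>\<^bsub>G\<^esub> = inv\<^bsub>G\<^esub> g \<otimes>\<^bsub>G\<^esub> h"
  unfolding word_dist_def
  by (rule LeastI_ex) (use ex_word[of "inv\<^bsub>G\<^esub> g \<otimes>\<^bsub>G\<^esub> h"] assms in auto)

lemma finite_wordball: "finite (wordball G S k)"
  unfolding wordball_def by (intro finite_imageI finite_lists_length_le) (use S in auto)

lemma wordball_carrier: "wordball G S k \<subseteq> carrier G"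
  unfolding wordball_def using foldr_mult_closed gens_closed by blast

lemma dist_wordball:
  assumes "g \<in> carrier G" "h \<in> carrier G" "word_dist G S g h \<le> k"
  shows "inv\<^bsub>G\<^esub> g \<otimes>\<^bsub>G\<^esub> h \<in> wordball G S k"
proof -
  from dist_word[OF assms(1,2)] obtain w where w: "length w = word_dist G S g h"
    "set w \<subseteq> S \<union> m_inv G ` S" "foldr (\<otimes>\<^bsub>G\<^esub>) w \<one>\<^bsub>G\<^esub> = inv\<^bsub>G\<^esub> g \<otimes>\<^bsub>G\<^esub> h" by blast
  with assms(3) show ?thesis unfolding wordball_def
    by (intro image_eqI[of _ _ w]) auto
qed

lemma chain1_support:
  assumes c: "c \<in> carrier (uf_chains G S 1)"
  shows "\<exists>T. finite T \<and> T \<subseteq> carrier G \<and> m_inv G ` T = T \<and>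
    (\<forall>x. c x \<noteq> 0 \<longrightarrow> (\<exists>g\<in>carrier G. \<exists>t\<in>T. x = [g, g \<otimes>\<^bsub>G\<^esub> t]))"
proof -
  from c obtain R where R: "R > 0" "\<forall>x\<in>tuples G 1. real (tuple_diam G S x) > R \<longrightarrow> c x = 0"
     and supp: "\<forall>x. x \<notin> tuples G 1 \<longrightarrow> c x = 0" by (auto simp: uf_chains_def)
  define k where "k = nat \<lfloor>R\<rfloor>"
  define T where "T = wordball G S k \<union> m_inv G ` wordball G S k"
  have Tc: "T \<subseteq> carrier G" using wordball_carrier unfolding T_def by auto
  have "m_inv G ` T = T"
    using wordball_carrier[of k] unfolding T_def by (auto simp: image_Un image_image subset_iff)
  moreover have "\<exists>g\<in>carrier G. \<exists>t\<in>T. x = [g, g \<otimes>\<^bsub>G\<^esub> t]" if "c x \<noteq> 0" for x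
  proof -
    from that supp have x: "x \<in> tuples G 1" by blast
    then obtain g h where gh: "x = [g, h]" "g \<in> carrier G" "h \<in> carrier G"
      by (auto simp: tuples_def length_Suc_conv)
    have "finite {word_dist G S (x ! i) (x ! j) | i j. i < length x \<and> j < length x}"
      by (rule finite_subset[of _ "(\<lambda>(i,j). word_dist G S (x ! i) (x ! j)) ` ({..<length x} \<times> {..<length x})"]) auto
    moreover have "word_dist G S g h = word_dist G S (x ! 0) (x ! 1) \<and> 0 < length x \<and> 1 < length x" using gh by auto
    ultimately have "word_dist G S g h \<le> tuple_diam G S x" unfolding tuple_diam_def
      by (intro Max_ge) blast+
    moreover have "real (tuple_diam G S x) \<le> R" using R x that by force
    ultimately have "word_dist G S g h \<le> k" unfolding k_def by linarith
    then have "inv\<^bsub>G\<^esub> g \<otimes>\<^bsub>G\<^esub> h \<in> T" using gh dist_wordball by (auto simp: T_def)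
    moreover have "h = g \<otimes>\<^bsub>G\<^esub> (inv\<^bsub>G\<^esub> g \<otimes>\<^bsub>G\<^esub> h)" using gh by (simp add: m_assoc[symmetric])
    ultimately show ?thesis using gh by metis
  qed
  ultimately show ?thesis using Tc finite_wordball by (intro exI[of _ T]) (auto simp: T_def)
qed

lemma boundary1:
  assumes c: "c \<in> carrier (uf_chains G S 1)"
    and T: "finite T" "T \<subseteq> carrier G" "m_inv G ` T = T"
    "\<forall>x. c x \<noteq> 0 \<longrightarrow> (\<exists>g\<in>carrier G. \<exists>t\<in>T. x = [g, g \<otimes>\<^bsub>G\<^esub> t])"
    and y: "y \<in> carrier G"
  shows "uf_boundary 1 c [y] = (\<Sum>t\<in>T. c [y \<otimes>\<^bsub>G\<^esub> t, y]) - (\<Sum>t\<in>T. c [y, y \<otimes>\<^bsub>G\<^esub> t])"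
proof -
  have A: "(\<Sum>x | c x \<noteq> 0 \<and> face 0 x = [y]. c x) = (\<Sum>t\<in>T. c [y \<otimes>\<^bsub>G\<^esub> t, y])"
  proof -
    have "(\<Sum>x | c x \<noteq> 0 \<and> face 0 x = [y]. c x) = (\<Sum>x\<in>(\<lambda>t. [y \<otimes>\<^bsub>G\<^esub> t, y]) ` T. c x)"
    proof (rule sum.mono_neutral_left)
      show "{x. c x \<noteq> 0 \<and> face 0 x = [y]} \<subseteq> (\<lambda>t. [y \<otimes>\<^bsub>G\<^esub> t, y]) ` T"
      proof
        fix x assume x: "x \<in> {x. c x \<noteq> 0 \<and> face 0 x = [y]}"
        then obtain g t where g: "g \<in> carrier G" "t \<in> T" "x = [g, g \<otimes>\<^bsub>G\<^esub> t]" using T(4) by blast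
        with x have "y = g \<otimes>\<^bsub>G\<^esub> t" by (auto simp: face_def)
        then have "g = y \<otimes>\<^bsub>G\<^esub> inv\<^bsub>G\<^esub> t" using g T(2) by (auto simp: m_assoc)
        then have "x = [y \<otimes>\<^bsub>G\<^esub> inv\<^bsub>G\<^esub> t, y]" using g(3) \<open>y = _\<close> by metis
        moreover have "inv\<^bsub>G\<^esub> t \<in> T" using g T(3) by blast
        ultimately show "x \<in> (\<lambda>t. [y \<otimes>\<^bsub>G\<^esub> t, y]) ` T" by blast
      qed
    qed (use T in \<open>auto simp: face_def\<close>)
    also have "\<dots> = (\<Sum>t\<in>T. c [y \<otimes>\<^bsub>G\<^esub> t, y])"
      using T(2) y by (subst sum.reindex) (auto simp: inj_on_def subset_iff)
    finally show ?thesis .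
  qed
  have B: "(\<Sum>x | c x \<noteq> 0 \<and> face 1 x = [y]. c x) = (\<Sum>t\<in>T. c [y, y \<otimes>\<^bsub>G\<^esub> t])"
  proof -
    have "(\<Sum>x | c x \<noteq> 0 \<and> face 1 x = [y]. c x) = (\<Sum>x\<in>(\<lambda>t. [y, y \<otimes>\<^bsub>G\<^esub> t]) ` T. c x)"
    proof (rule sum.mono_neutral_left)
      show "{x. c x \<noteq> 0 \<and> face 1 x = [y]} \<subseteq> (\<lambda>t. [y, y \<otimes>\<^bsub>G\<^esub> t]) ` T"
      proof
        fix x assume x: "x \<in> {x. c x \<noteq> 0 \<and> face 1 x = [y]}"
        then obtain g t where g: "g \<in> carrier G" "t \<in> T" "x = [g, g \<otimes>\<^bsub>G\<^esub> t]" using T(4) by blast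
        with x have "y = g" by (auto simp: face_def)
        then show "x \<in> (\<lambda>t. [y, y \<otimes>\<^bsub>G\<^esub> t]) ` T" using g by blast
      qed
    qed (use T in \<open>auto simp: face_def\<close>)
    also have "\<dots> = (\<Sum>t\<in>T. c [y, y \<otimes>\<^bsub>G\<^esub> t])"
      using T(2) y by (subst sum.reindex) (auto simp: inj_on_def subset_iff)
    finally show ?thesis .
  qed
  show ?thesis using A B by (simp add: uf_boundary_def numeral_eq_Suc)
qed

lemma mean_chain_boundary:
  assumes c: "c \<in> carrier (uf_chains G S 1)" and m: "m \<in> invariant_means G"
  shows "mean_chain G m (uf_boundary 1 c) = 0"
proof -
  from chain1_support[OF c] obtain T where T: "finite T" "T \<subseteq> carrier G" "m_inv G ` T = T"
    "\<forall>x. c x \<noteq> 0 \<longrightarrow> (\<exists>g\<in>carrier G. \<exists>t\<in>T. x = [g, g \<otimes>\<^bsub>G\<^esub> t])" by blast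
  define \<psi> where "\<psi> t g = (if g \<in> carrier G then c [inv\<^bsub>G\<^esub> g, inv\<^bsub>G\<^esub> g \<otimes>\<^bsub>G\<^esub> t] else 0)" for t g
  define \<theta> where "\<theta> t = left_translate G t (\<psi> (inv\<^bsub>G\<^esub> t))" for t
  from c obtain B where B: "\<And>x. \<bar>c x\<bar> \<le> B" by (auto simp: uf_chains_def bounded_iff)
  have B0: "0 \<le> B" using B[of "[]"] by linarith
  have psi: "\<psi> t \<in> linf G" for t
    using B B0 by (auto simp: linf_def \<psi>_def bounded_iff intro!: exI[of _ B])
  have th: "\<theta> t \<in> linf G" for t
    using B B0 by (auto simp: linf_def \<psi>_def \<theta>_def left_translate_def bounded_iff intro!: exI[of _ B])
  have neg: "(\<lambda>x. -1 * \<psi> t x) \<in> linf G \<and> m (\<lambda>x. -1 * \<psi> t x) = -1 * m (\<psi> t)" for t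
  proof
    show "(\<lambda>x. -1 * \<psi> t x) \<in> linf G" using psi[of t] by (simp add: linf_def bounded_iff)
    show "m (\<lambda>x. -1 * \<psi> t x) = -1 * m (\<psi> t)"
      by (rule mean_scale[OF m psi])
  qed
  have "(\<lambda>g. if g \<in> carrier G then uf_boundary 1 c [inv\<^bsub>G\<^esub> g] else 0)
      = (\<lambda>g. (\<Sum>t\<in>T. \<theta> t g) + (\<Sum>t\<in>T. -1 * \<psi> t g))"
  proof
    fix g
    show "(if g \<in> carrier G then uf_boundary 1 c [inv\<^bsub>G\<^esub> g] else 0) = (\<Sum>t\<in>T. \<theta> t g) + (\<Sum>t\<in>T. -1 * \<psi> t g)"
    proof (cases "g \<in> carrier G")
      case True
      have "\<theta> t g = c [inv\<^bsub>G\<^esub> g \<otimes>\<^bsub>G\<^esub> t, inv\<^bsub>G\<^esub> g]" if "t \<in> T" for t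
        using that T(2) True by (auto simp: \<theta>_def \<psi>_def left_translate_def inv_mult_group m_assoc subset_iff)
      moreover have "\<psi> t g = c [inv\<^bsub>G\<^esub> g, inv\<^bsub>G\<^esub> g \<otimes>\<^bsub>G\<^esub> t]" for t using True by (simp add: \<psi>_def)
      ultimately show ?thesis using boundary1[OF c T, of "inv\<^bsub>G\<^esub> g"] True
        by (simp add: sum_negf)
    qed (simp add: \<theta>_def \<psi>_def left_translate_def)
  qed
  then have "mean_chain G m (uf_boundary 1 c) = m (\<lambda>g. (\<Sum>t\<in>T. \<theta> t g) + (\<Sum>t\<in>T. -1 * \<psi> t g))"
    unfolding mean_chain_def by simp
  also have "\<dots> = m (\<lambda>g. (\<Sum>t\<in>T. \<theta> t g)) + m (\<lambda>g. (\<Sum>t\<in>T. -1 * \<psi> t g))"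
  proof -
    have "(\<lambda>g. (\<Sum>t\<in>T. \<theta> t g)) \<in> linf G" "(\<lambda>g. (\<Sum>t\<in>T. -1 * \<psi> t g)) \<in> linf G"
      using mean_sum[OF m T(1), of \<theta>] mean_sum[OF m T(1), of "\<lambda>t x. -1 * \<psi> t x"] th neg by blast+
    then show ?thesis by (intro mean_add[OF m])
  qed
  also have "\<dots> = (\<Sum>t\<in>T. m (\<theta> t)) + (\<Sum>t\<in>T. m (\<lambda>x. -1 * \<psi> t x))"
    using mean_sum[OF m T(1), of \<theta>] mean_sum[OF m T(1), of "\<lambda>t x. -1 * \<psi> t x"] th neg by simp
  also have "(\<Sum>t\<in>T. m (\<lambda>x. -1 * \<psi> t x)) = - (\<Sum>t\<in>T. m (\<psi> t))" using neg by (simp add: sum_negf)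
  also have "(\<Sum>t\<in>T. m (\<theta> t)) = (\<Sum>t\<in>T. m (\<psi> (inv\<^bsub>G\<^esub> t)))"
    unfolding \<theta>_def using T(2) by (intro sum.cong refl mean_trans[OF m psi]) blast
  also have "\<dots> = (\<Sum>t\<in>m_inv G ` T. m (\<psi> t))"
    using T(2) by (subst sum.reindex) (auto simp: inj_on_def subset_iff)
  finally show ?thesis using T(3) by simp
qed


lemma boundary1_outside:
  assumes c: "c \<in> carrier (uf_chains G S 1)" and y: "y \<notin> tuples G 0"
  shows "uf_boundary 1 c y = 0"
proof -
  from chain1_support[OF c] obtain T where T: "T \<subseteq> carrier G"
    "\<forall>x. c x \<noteq> 0 \<longrightarrow> (\<exists>g\<in>carrier G. \<exists>t\<in>T. x = [g, g \<otimes>\<^bsub>G\<^esub> t])" by blast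
  have "face 0 x \<noteq> y \<and> face 1 x \<noteq> y" if "c x \<noteq> 0" for x
    using T that y by (fastforce simp: face_def tuples_def)
  then have "{x. c x \<noteq> 0 \<and> face 0 x = y} = {}" "{x. c x \<noteq> 0 \<and> face (Suc 0) x = y} = {}" by auto
  then show ?thesis by (simp add: uf_boundary_def del: Collect_empty_eq)
qed

lemma tuples0: "y \<in> tuples G 0 \<longleftrightarrow> (\<exists>g\<in>carrier G. y = [g])"
  by (auto simp: tuples_def length_Suc_conv)

lemma uf_boundary_linear:
  assumes c: "c \<in> carrier (uf_chains G S 1)" and d: "d \<in> carrier (uf_chains G S 1)"
  shows "uf_boundary 1 (\<lambda>x. a * c x + d x) = (\<lambda>y. a * uf_boundary 1 c y + uf_boundary 1 d y)"
proof
  fix y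
  interpret C: vectorspace class_ring "uf_chains G S 1" by (rule uf_chains_vectorspace)
  have "a \<odot>\<^bsub>uf_chains G S 1\<^esub> c \<oplus>\<^bsub>uf_chains G S 1\<^esub> d \<in> carrier (uf_chains G S 1)"
    using c d by (intro C.M.add.m_closed C.smult_closed) simp_all
  then have acd: "(\<lambda>x. a * c x + d x) \<in> carrier (uf_chains G S 1)" by simp
  show "uf_boundary 1 (\<lambda>x. a * c x + d x) y = a * uf_boundary 1 c y + uf_boundary 1 d y"
  proof (cases "y \<in> tuples G 0")
    case True
    then obtain g where g: "g \<in> carrier G" "y = [g]" by (auto simp: tuples0)
    from chain1_support[OF c] obtain T where T: "finite T" "T \<subseteq> carrier G" "m_inv G ` T = T"
      "\<forall>x. c x \<noteq> 0 \<longrightarrow> (\<exists>g\<in>carrier G. \<exists>t\<in>T. x = [g, g \<otimes>\<^bsub>G\<^esub> t])" by blast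
    from chain1_support[OF d] obtain U where U: "finite U" "U \<subseteq> carrier G" "m_inv G ` U = U"
      "\<forall>x. d x \<noteq> 0 \<longrightarrow> (\<exists>g\<in>carrier G. \<exists>t\<in>U. x = [g, g \<otimes>\<^bsub>G\<^esub> t])" by blast
    let ?T = "T \<union> U"
    have F: "finite ?T" "?T \<subseteq> carrier G" "m_inv G ` ?T = ?T" using T U by (auto simp: image_Un)
    have "\<forall>x. c x \<noteq> 0 \<longrightarrow> (\<exists>g\<in>carrier G. \<exists>t\<in>?T. x = [g, g \<otimes>\<^bsub>G\<^esub> t])" using T by blast
    moreover have "\<forall>x. d x \<noteq> 0 \<longrightarrow> (\<exists>g\<in>carrier G. \<exists>t\<in>?T. x = [g, g \<otimes>\<^bsub>G\<^esub> t])" using U by blast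
    moreover from calculation have "\<forall>x. a * c x + d x \<noteq> 0 \<longrightarrow> (\<exists>g\<in>carrier G. \<exists>t\<in>?T. x = [g, g \<otimes>\<^bsub>G\<^esub> t])"
      by (metis add_0 mult_zero_right)
    ultimately have
      "uf_boundary 1 c [g] = (\<Sum>t\<in>?T. c [g \<otimes>\<^bsub>G\<^esub> t, g]) - (\<Sum>t\<in>?T. c [g, g \<otimes>\<^bsub>G\<^esub> t])"
      "uf_boundary 1 d [g] = (\<Sum>t\<in>?T. d [g \<otimes>\<^bsub>G\<^esub> t, g]) - (\<Sum>t\<in>?T. d [g, g \<otimes>\<^bsub>G\<^esub> t])"
      "uf_boundary 1 (\<lambda>x. a * c x + d x) [g] =
         (\<Sum>t\<in>?T. a * c [g \<otimes>\<^bsub>G\<^esub> t, g] + d [g \<otimes>\<^bsub>G\<^esub> t, g])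
         - (\<Sum>t\<in>?T. a * c [g, g \<otimes>\<^bsub>G\<^esub> t] + d [g, g \<otimes>\<^bsub>G\<^esub> t])"
      using boundary1[OF c F _ g(1)] boundary1[OF d F _ g(1)] boundary1[OF acd F _ g(1)] by blast+
    then show ?thesis
      unfolding g(2) by (simp only: sum.distrib sum_distrib_left[symmetric]) (simp add: algebra_simps)
  next
    case False
    then show ?thesis using boundary1_outside c d acd by simp
  qed
qed

lemma tuple_diam_singleton: 
  assumes "g \<in> carrier G" shows "tuple_diam G S [g] = 0"
proof -
  have "word_dist G S g g = 0" unfolding word_dist_def
    by (rule Least_eq_0) (use assms in auto)
  moreover have "{word_dist G S ([g] ! i) ([g] ! j) | i j. i < length [g] \<and> j < length [g]} = {word_dist G S g g}"
    by auto
  ultimately show ?thesis unfolding tuple_diam_def by simp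
qed

lemma uf_chains_0: "c \<in> carrier (uf_chains G S 0) \<longleftrightarrow> bounded (range c) \<and> (\<forall>x. x \<notin> tuples G 0 \<longrightarrow> c x = 0)"
  by (auto simp: uf_chains_def tuples0 tuple_diam_singleton intro!: exI[of _ "1::real"])

lemma uf_cycles_0: "uf_cycles G S 0 = carrier (uf_chains G S 0)"
  by (auto simp: uf_cycles_def uf_boundary_def)

lemma uf_boundary_closed:
  assumes c: "c \<in> carrier (uf_chains G S 1)"
  shows "uf_boundary 1 c \<in> carrier (uf_chains G S 0)"
proof -
  from chain1_support[OF c] obtain T where T: "finite T" "T \<subseteq> carrier G" "m_inv G ` T = T"
    "\<forall>x. c x \<noteq> 0 \<longrightarrow> (\<exists>g\<in>carrier G. \<exists>t\<in>T. x = [g, g \<otimes>\<^bsub>G\<^esub> t])" by blast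
  from c obtain B where B: "\<And>x. \<bar>c x\<bar> \<le> B" by (auto simp: uf_chains_def bounded_iff)
  have B0: "0 \<le> B" using B[of "[]"] by linarith
  have s: "\<bar>\<Sum>t\<in>T. c (f t)\<bar> \<le> real (card T) * B" for f
    using sum_norm_bound[of T "\<lambda>t. c (f t)" B] B by simp
  have "\<bar>uf_boundary 1 c y\<bar> \<le> 2 * (real (card T) * B)" for y
  proof (cases "y \<in> tuples G 0")
    case True
    then obtain g where g: "g \<in> carrier G" "y = [g]" by (auto simp: tuples0)
    show ?thesis unfolding g(2) boundary1[OF c T g(1)]
      using s[of "\<lambda>t. [g \<otimes>\<^bsub>G\<^esub> t, g]"] s[of "\<lambda>t. [g, g \<otimes>\<^bsub>G\<^esub> t]"] by linarith
  qed (use boundary1_outside[OF c] B0 in simp)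
  then show ?thesis using boundary1_outside[OF c] by (auto simp: uf_chains_0 bounded_iff)
qed

lemma uf_boundaries_0_subspace: "VectorSpace.subspace class_ring (uf_boundaries G S 0) (uf_chains G S 0)"
proof -
  interpret C: vectorspace class_ring "uf_chains G S 1" by (rule uf_chains_vectorspace)
  have z: "(\<lambda>x. 0) \<in> carrier (uf_chains G S 1)" using C.M.zero_closed by simp
  have zb: "uf_boundary 1 (\<lambda>x :: 'a list. 0) = (\<lambda>y. 0)" by (auto simp: uf_boundary_def)
  have "LinearCombinations.submodule class_ring (uf_boundaries G S 0) (uf_chains G S 0)"
  proof (rule LinearCombinations.submodule.intro)
    fix v w assume "v \<in> uf_boundaries G S 0" "w \<in> uf_boundaries G S 0"
    then obtain c d where cd: "c \<in> carrier (uf_chains G S 1)" "v = uf_boundary 1 c"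
      "d \<in> carrier (uf_chains G S 1)" "w = uf_boundary 1 d" by (auto simp: uf_boundaries_def)
    then have "uf_boundary 1 (\<lambda>x. c x + d x) = v \<oplus>\<^bsub>uf_chains G S 0\<^esub> w"
      using uf_boundary_linear[of c d 1] by simp
    moreover have "(\<lambda>x. c x + d x) \<in> carrier (uf_chains G S 1)"
      using cd C.M.add.m_closed[of c d] by simp
    ultimately show "v \<oplus>\<^bsub>uf_chains G S 0\<^esub> w \<in> uf_boundaries G S 0"
      unfolding uf_boundaries_def by (metis One_nat_def image_eqI)
  next
    fix a v assume "v \<in> uf_boundaries G S 0"
    then obtain c where cd: "c \<in> carrier (uf_chains G S 1)" "v = uf_boundary 1 c" by (auto simp: uf_boundaries_def)
    then have "uf_boundary 1 (\<lambda>x. a * c x) = a \<odot>\<^bsub>uf_chains G S 0\<^esub> v"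
      using uf_boundary_linear[OF cd(1) z, of a] cd(2) unfolding zb by simp
    moreover have "(\<lambda>x. a * c x) \<in> carrier (uf_chains G S 1)"
      using cd C.smult_closed[of a c] by simp
    ultimately show "a \<odot>\<^bsub>uf_chains G S 0\<^esub> v \<in> uf_boundaries G S 0"
      unfolding uf_boundaries_def by (metis One_nat_def image_eqI)
  next
    show "Module.module class_ring (uf_chains G S 0)" using uf_chains_vectorspace vectorspace_def by blast
    show "uf_boundaries G S 0 \<subseteq> carrier (uf_chains G S 0)"
      using uf_boundary_closed by (auto simp: uf_boundaries_def)
    show "\<zero>\<^bsub>uf_chains G S 0\<^esub> \<in> uf_boundaries G S 0"
      using z zb unfolding uf_boundaries_def by (intro image_eqI[of _ _ "\<lambda>x. 0"]) simp_all
  qed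
  then show ?thesis using uf_chains_vectorspace by (simp add: VectorSpace.subspace_def)
qed

lemma uf_homology_0: "uf_homology G S 0 = quot_module (uf_chains G S 0) (uf_boundaries G S 0)"
  by (simp add: uf_homology_def uf_cycles_0)

theorem uf_homology_0_vectorspace: "vectorspace class_ring (uf_homology G S 0)"
  unfolding uf_homology_0 by (rule quot_module_vectorspace[OF uf_boundaries_0_subspace])

lemma mean_chain_linear:
  assumes m: "m \<in> invariant_means G" and c: "c \<in> carrier (uf_chains G S 0)" "d \<in> carrier (uf_chains G S 0)"
  shows "mean_chain G m (\<lambda>x. a * c x + d x) = a * mean_chain G m c + mean_chain G m d"
proof -
  have l: "(\<lambda>g. if g \<in> carrier G then c [inv\<^bsub>G\<^esub> g] else 0) \<in> linf G" if c: "c \<in> carrier (uf_chains G S 0)" for c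
  proof -
    from c obtain B where "\<And>x. \<bar>c x\<bar> \<le> B" by (auto simp: uf_chains_0 bounded_iff)
    moreover from this[of "[]"] have "0 \<le> B" by linarith
    ultimately show ?thesis by (auto simp: linf_def bounded_iff intro!: exI[of _ B])
  qed
  interpret C: vectorspace class_ring "uf_chains G S 0" by (rule uf_chains_vectorspace)
  have "(\<lambda>x. a * c x) \<in> carrier (uf_chains G S 0)" using C.smult_closed[of a c] c by simp
  note l' = l[OF this]
  have "mean_chain G m (\<lambda>x. a * c x + d x) = m (\<lambda>g. (if g \<in> carrier G then a * c [inv\<^bsub>G\<^esub> g] else 0)
     + (if g \<in> carrier G then d [inv\<^bsub>G\<^esub> g] else 0))"
    unfolding mean_chain_def by (intro arg_cong[of _ _ m]) auto
  also have "\<dots> = m (\<lambda>g. if g \<in> carrier G then a * c [inv\<^bsub>G\<^esub> g] else 0) + mean_chain G m d"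
    unfolding mean_chain_def by (rule mean_add[OF m l' l[OF c(2)]])
  also have "m (\<lambda>g. if g \<in> carrier G then a * c [inv\<^bsub>G\<^esub> g] else 0) = 
      m (\<lambda>g. a * (if g \<in> carrier G then c [inv\<^bsub>G\<^esub> g] else 0))"
    by (intro arg_cong[of _ _ m]) auto
  also have "\<dots> = a * mean_chain G m c" unfolding mean_chain_def by (rule mean_scale[OF m l[OF c(1)]])
  finally show ?thesis .
qed

theorem mean_class_coset:
  assumes m: "m \<in> invariant_means G" and c: "c \<in> carrier (uf_chains G S 0)"
  shows "mean_class G m (uf_boundaries G S 0 +>\<^bsub>uf_chains G S 0\<^esub> c) = mean_chain G m c"
proof -
  have "mean_chain G m d = mean_chain G m c" if "d \<in> uf_boundaries G S 0 +>\<^bsub>uf_chains G S 0\<^esub> c" for d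
  proof -
    from that obtain b where b: "b \<in> carrier (uf_chains G S 1)" "d = (\<lambda>x. 1 * uf_boundary 1 b x + c x)"
      by (auto simp: a_r_coset_def' uf_boundaries_def)
    show ?thesis unfolding b(2) mean_chain_linear[OF m uf_boundary_closed[OF b(1)] c]
      using mean_chain_boundary[OF b(1) m] by simp
  qed
  moreover have "(\<lambda>y. 0) \<in> uf_boundaries G S 0"
    using LinearCombinations.submodule.zero_closed[of class_ring _ "uf_chains G S 0"] uf_boundaries_0_subspace
    unfolding VectorSpace.subspace_def by simp
  then have "c \<in> uf_boundaries G S 0 +>\<^bsub>uf_chains G S 0\<^esub> c"
    by (force simp: a_r_coset_def')
  ultimately have "mean_chain G m ` (uf_boundaries G S 0 +>\<^bsub>uf_chains G S 0\<^esub> c) = {mean_chain G m c}"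
    by blast
  then show ?thesis by (simp add: mean_class_def)
qed

theorem mean_invisible_subspace:
  "VectorSpace.subspace class_ring (mean_invisible G S) (uf_homology G S 0)"
proof -
  let ?C = "uf_chains G S 0" and ?B = "uf_boundaries G S 0" and ?H = "uf_homology G S 0"
  interpret C: vectorspace class_ring ?C by (rule uf_chains_vectorspace)
  interpret H: vectorspace class_ring ?H by (rule uf_homology_0_vectorspace)
  note sub = uf_boundaries_0_subspace
  have car: "X \<in> carrier ?H \<longleftrightarrow> (\<exists>c\<in>carrier ?C. X = ?B +>\<^bsub>?C\<^esub> c)" for X
    unfolding uf_homology_0 by (rule carrier_quot_module)
  have inv: "?B +>\<^bsub>?C\<^esub> c \<in> mean_invisible G S \<longleftrightarrow> (\<forall>m\<in>invariant_means G. mean_chain G m c = 0)"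
    if "c \<in> carrier ?C" for c
    using that mean_class_coset[OF _ that] car by (auto simp: mean_invisible_def)
  have rep: "\<exists>c\<in>carrier ?C. X = ?B +>\<^bsub>?C\<^esub> c" if "X \<in> mean_invisible G S" for X
    using that car by (auto simp: mean_invisible_def)
  have z: "(\<lambda>x. 0) \<in> carrier ?C" using C.M.zero_closed by simp
  have mz: "mean_chain G m (\<lambda>x. 0) = 0" if "m \<in> invariant_means G" for m
    using mean_chain_linear[OF that z z, of 1] by simp
  have "LinearCombinations.submodule class_ring (mean_invisible G S) ?H"
  proof (rule LinearCombinations.submodule.intro)
    show "Module.module class_ring ?H" by (rule H.module_axioms)
    show "mean_invisible G S \<subseteq> carrier ?H" by (auto simp: mean_invisible_def)
    have "\<zero>\<^bsub>?H\<^esub> = ?B +>\<^bsub>?C\<^esub> (\<lambda>x. 0)"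
      using quot_module_zero[OF sub] by (simp add: uf_homology_0)
    then show "\<zero>\<^bsub>?H\<^esub> \<in> mean_invisible G S" using inv[OF z] mz by simp
  next
    fix X Y assume "X \<in> mean_invisible G S" "Y \<in> mean_invisible G S"
    then obtain c d where c: "c \<in> carrier ?C" "X = ?B +>\<^bsub>?C\<^esub> c" "\<forall>m\<in>invariant_means G. mean_chain G m c = 0"
      and d: "d \<in> carrier ?C" "Y = ?B +>\<^bsub>?C\<^esub> d" "\<forall>m\<in>invariant_means G. mean_chain G m d = 0"
      using rep inv by metis
    have "X \<oplus>\<^bsub>?H\<^esub> Y = ?B +>\<^bsub>?C\<^esub> (\<lambda>x. c x + d x)"
      using quot_module_add[OF sub c(1) d(1)] c d by (simp add: uf_homology_0)
    moreover have "(\<lambda>x. c x + d x) \<in> carrier ?C" using C.M.add.m_closed[OF c(1) d(1)] by simp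
    moreover have "mean_chain G m (\<lambda>x. c x + d x) = 0" if "m \<in> invariant_means G" for m
      using mean_chain_linear[OF that c(1) d(1), of 1] c(3) d(3) that by simp
    ultimately show "X \<oplus>\<^bsub>?H\<^esub> Y \<in> mean_invisible G S" using inv by simp
  next
    fix a X assume "X \<in> mean_invisible G S"
    then obtain c where c: "c \<in> carrier ?C" "X = ?B +>\<^bsub>?C\<^esub> c" "\<forall>m\<in>invariant_means G. mean_chain G m c = 0"
      using rep inv by metis
    have "a \<odot>\<^bsub>?H\<^esub> X = ?B +>\<^bsub>?C\<^esub> (\<lambda>x. a * c x)"
      using quot_module_smult[OF sub _ c(1), of a] c by (simp add: uf_homology_0)
    moreover have "(\<lambda>x. a * c x) \<in> carrier ?C" using C.smult_closed[OF _ c(1), of a] by simp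
    moreover have "mean_chain G m (\<lambda>x. a * c x) = 0" if "m \<in> invariant_means G" for m
      using mean_chain_linear[OF that c(1) z, of a] c(3) mz that by simp
    ultimately show "a \<odot>\<^bsub>?H\<^esub> X \<in> mean_invisible G S" using inv by simp
  qed
  then show ?thesis using H.vectorspace_axioms by (simp add: VectorSpace.subspace_def)
qed

theorem visible_quotient_vectorspace:
  "vectorspace class_ring (quot_module (uf_homology G S 0) (mean_invisible G S))"
  by (rule quot_module_vectorspace[OF mean_invisible_subspace])

end

end

theory Submission
  imports Defs
begin

text \<open>
  Enumerate \<open>G = {g\<^sub>0, g\<^sub>1, \<dots>}\<close> and put \<open>B\<^sub>n = {g\<^sub>0, \<dots>, g\<^sub>n}\<close>.  As \<open>G\<close> is infinite, there are \<open>h\<^sub>n\<close>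
  such that the translates \<open>B\<^sub>n h\<^sub>n\<close> are pairwise disjoint.  Split \<open>\<nat>\<close> into infinitely many infinite
  sets \<open>N\<^sub>i\<close> and let \<open>A\<^sub>i\<close> be the union of the \<open>B\<^sub>n h\<^sub>n\<close> with \<open>n \<in> N\<^sub>i\<close>.  For fixed \<open>g\<close> and all large
  \<open>n \<in> N\<^sub>i\<close>, the product \<open>g h\<^sub>n\<close> lies in \<open>A\<^sub>i\<close> and in no other \<open>A\<^sub>j\<close>.
  Hence averaging \<open>\<phi> (g h\<^sub>n)\<close> first over \<open>n \<in> N\<^sub>i\<close> by a mean that ignores finite sets, and then
  over \<open>g\<close> by an invariant mean, gives invariant means \<open>m\<^sub>i\<close> with \<open>m\<^sub>i (\<chi>\<^bsub>A\<^sub>j\<^esub>) = \<delta>\<^sub>i\<^sub>j\<close>.  Transported to chains, the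
  \<open>\<chi>\<^bsub>A\<^sub>j\<^esub>\<close> are therefore linearly independent modulo the mean-invisible part.  For the inner average,
  an invariant mean on \<open>G\<close> serves again, through the enumeration: it vanishes on finite sets because
  \<open>G\<close> is infinite.
\<close>

section \<open>Linear functionals and infinite dimension\<close>

definition linear_functional :: "('k::field, 'v, 'm) module_scheme \<Rightarrow> ('v \<Rightarrow> 'k) \<Rightarrow> bool" where
  "linear_functional V L \<longleftrightarrow>
     (\<forall>v\<in>carrier V. \<forall>w\<in>carrier V. L (v \<oplus>\<^bsub>V\<^esub> w) = L v + L w) \<and>
     (\<forall>a. \<forall>v\<in>carrier V. L (a \<odot>\<^bsub>V\<^esub> v) = a * L v)"

lemma linear_functional_lincomb:
  fixes V :: "('k::field, 'v, 'm) module_scheme"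
  assumes V: "vectorspace class_ring V" and L: "linear_functional V L"
    and "finite A" "A \<subseteq> carrier V"
  shows "L (LinearCombinations.module.lincomb V a A) = (\<Sum>v\<in>A. a v * L v)"
  using assms(3,4)
proof (induction A rule: finite_induct)
  interpret V: vectorspace class_ring V by (rule V)
  case empty
  \<comment> \<open>\<open>linear_functional\<close> does not mention zero; its value there comes
    from homogeneity with the scalar 0.\<close>
  have "L (0 \<odot>\<^bsub>V\<^esub> \<zero>\<^bsub>V\<^esub>) = 0 * L \<zero>\<^bsub>V\<^esub>"
    using L V.M.zero_closed unfolding linear_functional_def by blast
  moreover have "0 \<odot>\<^bsub>V\<^esub> \<zero>\<^bsub>V\<^esub> = \<zero>\<^bsub>V\<^esub>" using V.smult_r_null[of 0] by simp
  ultimately show ?case by (simp add: V.lincomb_def)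
next
  interpret V: vectorspace class_ring V by (rule V)
  case (insert v A)
  have s: "a w \<odot>\<^bsub>V\<^esub> w \<in> carrier V" if "w \<in> carrier V" for w
    using V.smult_closed[OF _ that, of "a w"] by simp
  have "V.lincomb a (insert v A) = a v \<odot>\<^bsub>V\<^esub> v \<oplus>\<^bsub>V\<^esub> V.lincomb a A"
    unfolding V.lincomb_def using insert.hyps insert.prems s by (intro V.M.finsum_insert) auto
  moreover have "V.lincomb a A \<in> carrier V"
    unfolding V.lincomb_def using insert.prems s by (intro V.M.finsum_closed) auto
  ultimately show ?case
    using L insert s[of v] by (simp add: linear_functional_def)
qed

text \<open>Applying \<open>L i\<close> to a vanishing combination isolates the coefficient of
  \<open>v i\<close>, so the \<open>v j\<close> are independent. They are pairwise distinct for the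
  same reason, while independent sets in a finite-dimensional space are finite.\<close>

lemma not_fin_dim_biorthogonal:
  fixes V :: "('k::field, 'v, 'm) module_scheme" and v :: "nat \<Rightarrow> 'v"
  assumes V: "vectorspace class_ring V"
    and L: "\<And>i. linear_functional V (L i)" and v: "\<And>j. v j \<in> carrier V"
    and Lv: "\<And>i j. L i (v j) = of_bool (i = j)"
  shows "\<not> vectorspace.fin_dim class_ring V"
proof
  interpret V: vectorspace class_ring V by (rule V)
  assume fd: "V.fin_dim"
  have "inj v"
    by (rule injI) (metis Lv of_bool_eq_1_iff)
  have "V.lin_indpt (range v)"
  proof
    assume "V.lin_dep (range v)"
    then obtain A a u where A: "finite A" "A \<subseteq> range v" and z: "V.lincomb a A = \<zero>\<^bsub>V\<^esub>"
      and u: "u \<in> A" "a u \<noteq> 0"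
      unfolding V.lin_dep_def by auto
    then obtain i where i: "v i \<in> A" "a (v i) \<noteq> 0" by auto
    have AV: "A \<subseteq> carrier V" using A v by auto
    have "V.lincomb a {} = \<zero>\<^bsub>V\<^esub>" by (simp add: V.lincomb_def)
    with linear_functional_lincomb[OF V L, of "{}" i a] have "L i \<zero>\<^bsub>V\<^esub> = 0" by simp
    then have "0 = (\<Sum>w\<in>A. a w * L i w)"
      using linear_functional_lincomb[OF V L A(1) AV, of i a] z by simp
    also have "\<dots> = (\<Sum>w\<in>{v i}. a w * L i w)"
      using A i(1) by (intro sum.mono_neutral_right) (auto simp: Lv)
    also have "\<dots> = a (v i)" by (simp add: Lv)
    finally show False using i by simp
  qed
  then have "finite (range v)" using v by (intro V.fin_dim_li_fin[OF fd]) auto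
  with \<open>inj v\<close> show False using finite_imageD by blast
qed

text \<open>Vanishing on \<open>W\<close> makes \<open>L\<close> constant on each coset, so the
  image of a coset is a singleton. The \<open>the_elem\<close> form agrees with
  \<open>mean_class\<close>; the lemma serves for both descents, from chains to homology and from
  homology to its quotient by the mean-invisible part.\<close>

lemma quot_module_functional:
  fixes V :: "('k::field, 'v, 'm) module_scheme"
  assumes W: "VectorSpace.subspace class_ring W V"
    and L: "linear_functional V L" and z: "\<And>w. w \<in> W \<Longrightarrow> L w = 0"
  shows "linear_functional (quot_module V W) (\<lambda>X. the_elem (L ` X))"
    and "v \<in> carrier V \<Longrightarrow> the_elem (L ` (W +>\<^bsub>V\<^esub> v)) = L v"
proof -
  interpret V: vectorspace class_ring V using W by (simp add: VectorSpace.subspace_def)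
  interpret W: LinearCombinations.submodule class_ring W V
    using W by (simp add: VectorSpace.subspace_def)
  have val: "the_elem (L ` (W +>\<^bsub>V\<^esub> v)) = L v" if v: "v \<in> carrier V" for v
  proof -
    have "L (w \<oplus>\<^bsub>V\<^esub> v) = L v" if "w \<in> W" for w
      using L z[OF that] that v W.subset unfolding linear_functional_def by auto
    then have "L ` (W +>\<^bsub>V\<^esub> v) \<subseteq> {L v}" unfolding a_r_coset_def' by auto
    moreover have "W +>\<^bsub>V\<^esub> v \<noteq> {}" using W.zero_closed unfolding a_r_coset_def' by blast
    ultimately have "L ` (W +>\<^bsub>V\<^esub> v) = {L v}" by (metis image_is_empty subset_singletonD)
    then show ?thesis by simp
  qed
  then show "v \<in> carrier V \<Longrightarrow> the_elem (L ` (W +>\<^bsub>V\<^esub> v)) = L v" .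
  show "linear_functional (quot_module V W) (\<lambda>X. the_elem (L ` X))"
    unfolding linear_functional_def
  proof (intro conjI ballI allI)
    fix X Y assume "X \<in> carrier (quot_module V W)" "Y \<in> carrier (quot_module V W)"
    then obtain v w where "v \<in> carrier V" "X = W +>\<^bsub>V\<^esub> v" "w \<in> carrier V" "Y = W +>\<^bsub>V\<^esub> w"
      by (auto simp: carrier_quot_module)
    then show "the_elem (L ` (X \<oplus>\<^bsub>quot_module V W\<^esub> Y)) = the_elem (L ` X) + the_elem (L ` Y)"
      using L by (simp add: quot_module_add[OF W] val linear_functional_def)
  next
    fix a X assume "X \<in> carrier (quot_module V W)"
    then obtain v where v: "v \<in> carrier V" "X = W +>\<^bsub>V\<^esub> v" by (auto simp: carrier_quot_module)
    moreover have "a \<odot>\<^bsub>V\<^esub> v \<in> carrier V" using V.smult_closed[OF _ v(1), of a] by simp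
    ultimately show "the_elem (L ` (a \<odot>\<^bsub>quot_module V W\<^esub> X)) = a * the_elem (L ` X)"
      using L by (simp add: quot_module_smult[OF W] val linear_functional_def)
  qed
qed


section \<open>Invariant means on infinite groups\<close>

lemma linf_iff: "\<phi> \<in> linf G \<longleftrightarrow> (\<exists>C. \<forall>x. \<bar>\<phi> x\<bar> \<le> C) \<and> (\<forall>x. x \<notin> carrier G \<longrightarrow> \<phi> x = 0)"
  by (auto simp: linf_def bounded_iff)

lemma linf_add: "\<phi> \<in> linf G \<Longrightarrow> \<psi> \<in> linf G \<Longrightarrow> (\<lambda>x. \<phi> x + \<psi> x) \<in> linf G"
  unfolding linf_iff by (metis abs_triangle_ineq add_0 add_mono order_trans)

lemma linf_scale: "\<phi> \<in> linf G \<Longrightarrow> (\<lambda>x. a * \<phi> x) \<in> linf G"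
  unfolding linf_iff by (metis abs_ge_zero abs_mult mult_left_mono mult_zero_right)

lemma linf_bounded_on:
  assumes "\<And>x. x \<in> carrier G \<Longrightarrow> \<bar>\<phi> x\<bar> \<le> C"
  shows "(\<lambda>x. if x \<in> carrier G then \<phi> x else 0) \<in> linf G"
proof -
  \<comment> \<open>The absolute value covers an empty carrier, where \<open>C\<close> may be
    negative.\<close>
  have "\<bar>if x \<in> carrier G then \<phi> x else 0\<bar> \<le> \<bar>C\<bar>" for x using assms[of x] by auto
  then show ?thesis unfolding linf_iff by (intro conjI exI[of _ "\<bar>C\<bar>"]) auto
qed

lemma mean_nonneg:
  "m \<in> invariant_means G \<Longrightarrow> \<phi> \<in> linf G \<Longrightarrow> (\<And>x. x \<in> carrier G \<Longrightarrow> 0 \<le> \<phi> x) \<Longrightarrow> 0 \<le> m \<phi>"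
  by (simp add: invariant_means_def)

lemma mean_const:
  assumes "m \<in> invariant_means G"
  shows "m (\<lambda>x. if x \<in> carrier G then a else 0) = a"
proof -
  have "indicator (carrier G) \<in> linf G" by (auto simp: linf_iff indicator_def intro!: exI[of _ 1])
  from mean_scale[OF assms this, of a]
  have "m (\<lambda>x. a * indicator (carrier G) x) = a" using assms by (simp add: invariant_means_def)
  also have "(\<lambda>x. a * indicator (carrier G) x) = (\<lambda>x. if x \<in> carrier G then a else 0)" by auto
  finally show ?thesis .
qed

lemma mean_mono:
  assumes m: "m \<in> invariant_means G" and "\<phi> \<in> linf G" "\<psi> \<in> linf G"
    and "\<And>x. x \<in> carrier G \<Longrightarrow> \<phi> x \<le> \<psi> x"
  shows "m \<phi> \<le> m \<psi>"
proof -
  have n: "(\<lambda>x. -1 * \<phi> x) \<in> linf G" by (rule linf_scale[OF assms(2)])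
  have "0 \<le> m (\<lambda>x. \<psi> x + -1 * \<phi> x)"
    using assms by (intro mean_nonneg[OF m] linf_add n) auto
  also have "\<dots> = m \<psi> + -1 * m \<phi>"
    using mean_add[OF m assms(3) n] mean_scale[OF m assms(2), of "-1"] by simp
  finally show ?thesis by simp
qed

lemma mean_abs_le:
  assumes m: "m \<in> invariant_means G" and \<phi>: "\<phi> \<in> linf G" "\<And>x. x \<in> carrier G \<Longrightarrow> \<bar>\<phi> x\<bar> \<le> C"
  shows "\<bar>m \<phi>\<bar> \<le> C"
proof -
  have c: "(\<lambda>x. if x \<in> carrier G then a else 0) \<in> linf G" for a :: real
    by (rule linf_bounded_on[of _ _ "\<bar>a\<bar>"]) simp
  have "m \<phi> \<le> C"
    using mean_mono[OF m \<phi>(1) c[of C]] \<phi>(2) mean_const[OF m, of C] by (simp add: abs_le_iff)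
  moreover have "- C \<le> m \<phi>"
    using mean_mono[OF m c[of "- C"] \<phi>(1)] \<phi>(2) mean_const[OF m, of "- C"] by (simp add: abs_le_iff minus_le_iff)
  ultimately show ?thesis by (simp add: abs_le_iff)
qed

section \<open>Invariant means ignore finite sets\<close>

lemma (in group) linf_indicator_singleton: "x \<in> carrier G \<Longrightarrow> indicator {x} \<in> linf G"
  by (auto simp: linf_iff indicator_def intro!: exI[of _ 1])

text \<open>All singletons are translates of one another, hence have the same mean. Any
  \<open>k\<close> of them have total mean at most 1, for every \<open>k\<close>.\<close>

lemma (in group) mean_singleton:
  assumes m: "m \<in> invariant_means G" and inf: "infinite (carrier G)" and x: "x \<in> carrier G"
  shows "m (indicator {x}) = 0"
proof -
  have trans: "m (indicator {y}) = m (indicator {x})" if y: "y \<in> carrier G" for y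
  proof -
    have "left_translate G (y \<otimes> inv x) (indicator {x}) = (indicator {y} :: 'a \<Rightarrow> real)"
    proof
      fix z
      have "inv (y \<otimes> inv x) \<otimes> z = x \<longleftrightarrow> z = y" if z: "z \<in> carrier G"
      proof -
        have "inv (y \<otimes> inv x) \<otimes> z = x \<otimes> (inv y \<otimes> z)"
          using x y z by (simp add: inv_mult_group m_assoc)
        also have "\<dots> = x \<longleftrightarrow> inv y \<otimes> z = \<one>" using x y z by simp
        also have "\<dots> \<longleftrightarrow> z = y" using y z inv_solve_left'[of \<one> y z] by simp
        finally show ?thesis .
      qed
      then show "left_translate G (y \<otimes> inv x) (indicator {x}) z = indicator {y} z"
        using y by (auto simp: left_translate_def indicator_def)
    qed
    then show ?thesis
      using mean_trans[OF m linf_indicator_singleton[OF x], of "y \<otimes> inv x"] x y by simp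
  qed
  have nn: "0 \<le> m (indicator {x})"
    by (rule mean_nonneg[OF m linf_indicator_singleton[OF x]]) simp
  have "real k * m (indicator {x}) \<le> 1" for k
  proof -
    obtain F where F: "F \<subseteq> carrier G" "finite F" "card F = k"
      using infinite_arbitrarily_large[OF inf] by metis
    have s: "(\<lambda>z. \<Sum>y\<in>F. indicator {y} z) \<in> linf G"
      "m (\<lambda>z. \<Sum>y\<in>F. indicator {y} z) = (\<Sum>y\<in>F. m (indicator {y}))"
      using mean_sum[OF m F(2), of "\<lambda>y. indicator {y}"] F linf_indicator_singleton by blast+
    have "real k * m (indicator {x}) = (\<Sum>y\<in>F. m (indicator {y}))"
      using F trans by (simp add: subset_iff)
    also have "\<dots> \<le> 1"
    proof -
      have "(\<Sum>y\<in>F. indicator {y} z) = (of_bool (z \<in> F) :: real)" for z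
        using F(2) by (simp add: indicator_def)
      then have "\<bar>m (\<lambda>z. \<Sum>y\<in>F. indicator {y} z)\<bar> \<le> 1"
        by (intro mean_abs_le[OF m s(1)]) simp
      then show ?thesis using s(2) by simp
    qed
    finally show ?thesis .
  qed
  then show ?thesis
    using nn reals_Archimedean3[of "m (indicator {x})"] by (metis less_le not_le)
qed

text \<open>Such a function is a finite combination of indicators of points, each of mean 0.\<close>

lemma (in group) mean_finite_support:
  assumes m: "m \<in> invariant_means G" and inf: "infinite (carrier G)"
    and F: "finite F" "F \<subseteq> carrier G" and supp: "\<And>x. x \<notin> F \<Longrightarrow> \<phi> x = 0"
  shows "\<phi> \<in> linf G" and "m \<phi> = 0"
proof -
  have eq: "\<phi> = (\<lambda>z. \<Sum>y\<in>F. \<phi> y * indicator {y} z)"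
  proof
    fix z
    have "(\<Sum>y\<in>F. \<phi> y * indicator {y} z) = (\<Sum>y\<in>F. if y = z then \<phi> y else 0)"
      by (intro sum.cong) (auto simp: indicator_def)
    then show "\<phi> z = (\<Sum>y\<in>F. \<phi> y * indicator {y} z)" using F supp[of z] by simp
  qed
  have l: "(\<lambda>z. \<phi> y * indicator {y} z) \<in> linf G" if "y \<in> F" for y
    using that F linf_indicator_singleton by (intro linf_scale) blast
  have "m (\<lambda>z. \<phi> y * indicator {y} z) = 0" if "y \<in> F" for y
    using that F mean_scale[OF m linf_indicator_singleton, of y] mean_singleton[OF m inf, of y] by auto
  then show "\<phi> \<in> linf G" "m \<phi> = 0"
    using mean_sum[OF m F(1), of "\<lambda>y z. \<phi> y * indicator {y} z"] l eq by auto
qed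

text \<open>Subtracting the constant leaves a finitely supported function. Thus \<open>m\<close>
  acts as a limit on functions that are constant off a finite set.\<close>

lemma (in group) mean_eventually_const:
  assumes m: "m \<in> invariant_means G" and inf: "infinite (carrier G)"
    and F: "finite F" and c: "\<And>x. x \<in> carrier G - F \<Longrightarrow> \<phi> x = a"
  shows "m (\<lambda>x. if x \<in> carrier G then \<phi> x else 0) = a"
proof -
  define \<psi> where "\<psi> x = (if x \<in> carrier G then \<phi> x - a else 0)" for x
  have "\<psi> x = 0" if "x \<notin> F \<inter> carrier G" for x
    using that c by (auto simp: \<psi>_def)
  then have "\<psi> \<in> linf G" "m \<psi> = 0"
    using F by (intro mean_finite_support[OF m inf, of "F \<inter> carrier G"]; simp)+
  moreover have "(\<lambda>x. if x \<in> carrier G then a else 0) \<in> linf G"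
    by (rule linf_bounded_on[of _ _ "\<bar>a\<bar>"]) simp
  ultimately have "m (\<lambda>x. \<psi> x + (if x \<in> carrier G then a else 0)) = a"
    using mean_add[OF m] mean_const[OF m, of a] by simp
  moreover have "(\<lambda>x. \<psi> x + (if x \<in> carrier G then a else 0)) = (\<lambda>x. if x \<in> carrier G then \<phi> x else 0)"
    by (auto simp: \<psi>_def)
  ultimately show ?thesis by simp
qed

section \<open>Averaging along a family of points\<close>

text \<open>The carrier also indexes the family \<open>w\<close>, so that the same mean
  \<open>m\<close> can take both averages.\<close>

definition orbit_mean ::
    "('a, 'b) monoid_scheme \<Rightarrow> (('a \<Rightarrow> real) \<Rightarrow> real) \<Rightarrow> ('a \<Rightarrow> 'a) \<Rightarrow> ('a \<Rightarrow> real) \<Rightarrow> real" where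
  "orbit_mean G m w \<phi> =
     m (\<lambda>g. if g \<in> carrier G
            then m (\<lambda>k. if k \<in> carrier G then \<phi> (g \<otimes>\<^bsub>G\<^esub> w k) else 0) else 0)"

text \<open>Left multiplication by \<open>g\<close> commutes with right multiplication by
  \<open>w k\<close>, so translating \<open>\<phi>\<close> translates its inner average, seen as a
  function on the group. Invariance of the outer mean then suffices, whatever \<open>w\<close>
  is.\<close>

lemma (in group) orbit_mean_invariant:
  assumes m: "m \<in> invariant_means G" and w: "w \<in> carrier G \<rightarrow> carrier G"
  shows "orbit_mean G m w \<in> invariant_means G"
proof -
  define I where "I \<phi> g = (\<lambda>k. if k \<in> carrier G then \<phi> (g \<otimes> w k) else 0 :: real)" for \<phi> g
  define J where "J \<phi> = (\<lambda>g. if g \<in> carrier G then m (I \<phi> g) else 0)" for \<phi>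
  have om: "orbit_mean G m w \<phi> = m (J \<phi>)" for \<phi>
    unfolding orbit_mean_def I_def J_def ..
  have I: "I \<phi> g \<in> linf G" if "\<phi> \<in> linf G" for \<phi> g
  proof -
    from that obtain C where "\<And>x. \<bar>\<phi> x\<bar> \<le> C" by (auto simp: linf_iff)
    then show ?thesis unfolding I_def by (intro linf_bounded_on)
  qed
  have J: "J \<phi> \<in> linf G" if \<phi>: "\<phi> \<in> linf G" for \<phi>
  proof -
    from \<phi> obtain C where "\<And>x. \<bar>\<phi> x\<bar> \<le> C" by (auto simp: linf_iff)
    then have "\<bar>m (I \<phi> g)\<bar> \<le> C" for g
      by (intro mean_abs_le[OF m I[OF \<phi>]]) (simp add: I_def)
    then show ?thesis unfolding J_def by (rule linf_bounded_on)
  qed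
  have "orbit_mean G m w (\<lambda>x. \<phi> x + \<psi> x) = orbit_mean G m w \<phi> + orbit_mean G m w \<psi>"
    if "\<phi> \<in> linf G" "\<psi> \<in> linf G" for \<phi> \<psi>
  proof -
    have "I (\<lambda>x. \<phi> x + \<psi> x) g = (\<lambda>k. I \<phi> g k + I \<psi> g k)" for g by (auto simp: I_def)
    then have "J (\<lambda>x. \<phi> x + \<psi> x) = (\<lambda>g. J \<phi> g + J \<psi> g)"
      using that by (auto simp: J_def mean_add[OF m I I])
    then show ?thesis using that by (simp add: om mean_add[OF m J J])
  qed
  moreover have "orbit_mean G m w (\<lambda>x. a * \<phi> x) = a * orbit_mean G m w \<phi>"
    if "\<phi> \<in> linf G" for \<phi> a
  proof -
    have "I (\<lambda>x. a * \<phi> x) g = (\<lambda>k. a * I \<phi> g k)" for g by (auto simp: I_def)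
    then have "J (\<lambda>x. a * \<phi> x) = (\<lambda>g. a * J \<phi> g)"
      using that by (auto simp: J_def mean_scale[OF m I])
    then show ?thesis using that by (simp add: om mean_scale[OF m J])
  qed
  moreover have "orbit_mean G m w (indicator (carrier G)) = 1"
  proof -
    have "I (indicator (carrier G)) g = (\<lambda>k. if k \<in> carrier G then 1 else 0)" if "g \<in> carrier G" for g
      using that w by (auto simp: I_def fun_eq_iff indicator_def Pi_iff)
    then have "J (indicator (carrier G)) = (\<lambda>g. if g \<in> carrier G then 1 else 0)"
      using mean_const[OF m, of 1] by (auto simp: J_def)
    then show ?thesis by (simp add: om mean_const[OF m])
  qed
  moreover have "0 \<le> orbit_mean G m w \<phi>"
    if \<phi>: "\<phi> \<in> linf G" "\<forall>x\<in>carrier G. 0 \<le> \<phi> x" for \<phi>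
  proof -
    have "0 \<le> m (I \<phi> g)" if "g \<in> carrier G" for g
      using that \<phi> w by (intro mean_nonneg[OF m I]) (auto simp: I_def)
    then show ?thesis
      unfolding om using \<phi> by (intro mean_nonneg[OF m J]) (auto simp: J_def)
  qed
  moreover have "orbit_mean G m w (left_translate G g \<phi>) = orbit_mean G m w \<phi>"
    if g: "g \<in> carrier G" and \<phi>: "\<phi> \<in> linf G" for g \<phi>
  proof -
    have "I (left_translate G g \<phi>) x = I \<phi> (inv g \<otimes> x)" if "x \<in> carrier G" for x
      using that g w by (auto simp: I_def left_translate_def m_assoc Pi_iff fun_eq_iff)
    then have "J (left_translate G g \<phi>) x = left_translate G g (J \<phi>) x" for x
      using g by (simp add: left_translate_def[of G g "J \<phi>"]) (simp add: J_def)
    then have "J (left_translate G g \<phi>) = left_translate G g (J \<phi>)" ..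
    then show ?thesis using mean_trans[OF m J[OF \<phi>] g] by (simp add: om)
  qed
  ultimately show ?thesis by (simp add: invariant_means_def)
qed

section \<open>Separating sets by means\<close>

text \<open>Choose \<open>h n\<close> recursively. A collision
  \<open>x \<otimes> h n = y \<otimes> h k\<close> with \<open>k < n\<close> determines
  \<open>h n\<close> from \<open>x\<close>, \<open>y\<close> and \<open>k\<close>, so only finitely
  many values are forbidden at each stage.\<close>

lemma (in group) disjoint_translates:
  fixes B :: "nat \<Rightarrow> 'a set"
  assumes inf: "infinite (carrier G)" and B: "\<And>n. finite (B n)" "\<And>n. B n \<subseteq> carrier G"
  obtains h where "\<And>n. h n \<in> carrier G"
    and "\<And>n k x y. x \<in> B n \<Longrightarrow> y \<in> B k \<Longrightarrow> x \<otimes> h n = y \<otimes> h k \<Longrightarrow> n = k"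
proof -
  define P where "P f n r \<longleftrightarrow> r \<in> carrier G \<and> (\<forall>k<n. \<forall>x\<in>B n. \<forall>y\<in>B k. x \<otimes> r \<noteq> y \<otimes> f k)"
    for f :: "nat \<Rightarrow> 'a" and n r
  have "\<exists>h. \<forall>n. P h n (h n)"
  \<comment> \<open>The goal left to the closing \<open>auto\<close> is that \<open>P f n\<close>
    depends on \<open>f\<close> only below \<open>n\<close>.\<close>
  proof (rule dependent_wellorder_choice)
    fix n f assume f: "\<And>k. k < n \<Longrightarrow> P f k (f k)"
    define E where "E = (\<Union>k<n. (\<lambda>(x, y). inv x \<otimes> (y \<otimes> f k)) ` (B n \<times> B k))"
    have "finite E" unfolding E_def using B by auto
    then have "carrier G - E \<noteq> {}" using inf by (metis Diff_eq_empty_iff finite_subset)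
    then obtain r where r: "r \<in> carrier G" "r \<notin> E" by blast
    have "x \<otimes> r \<noteq> y \<otimes> f k" if k: "k < n" and xy: "x \<in> B n" "y \<in> B k" for k x y
    proof
      assume eq: "x \<otimes> r = y \<otimes> f k"
      have "x \<in> carrier G" using B xy by auto
      then have "r = inv x \<otimes> (y \<otimes> f k)" using r(1) by (simp add: eq[symmetric] m_assoc[symmetric])
      with k xy have "r \<in> E" unfolding E_def by force
      with r(2) show False ..
    qed
    with r show "\<exists>r. P f n r" unfolding P_def by blast
  qed (auto simp: P_def)
  then obtain h where h: "\<And>n. P h n (h n)" by blast
  show thesis
  proof (rule that)
    show "h n \<in> carrier G" for n using h by (simp add: P_def)
    show "n = k" if "x \<in> B n" "y \<in> B k" "x \<otimes> h n = y \<otimes> h k" for n k x y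
      using that h[of n] h[of k] unfolding P_def by (metis linorder_neqE_nat)
  qed
qed

lemma (in group) separated_invariant_means:
  assumes cnt: "countable (carrier G)" and inf: "infinite (carrier G)" and "amenable G"
  obtains M :: "nat \<Rightarrow> ('a \<Rightarrow> real) \<Rightarrow> real" and A :: "nat \<Rightarrow> 'a set"
  where "\<And>i. M i \<in> invariant_means G" and "\<And>i. A i \<subseteq> carrier G"
    and "\<And>i j. M i (indicator (A j)) = of_bool (i = j)"
proof -
  from \<open>amenable G\<close> obtain m where m: "m \<in> invariant_means G" by (auto simp: amenable_def)
  define idx where "idx = to_nat_on (carrier G)"
  have idx: "inj_on idx (carrier G)" unfolding idx_def by (rule inj_on_to_nat_on[OF cnt])
  define B where "B n = {g \<in> carrier G. idx g \<le> n}" for n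
  have finB: "finite (B n)" for n
  proof -
    have "idx ` B n \<subseteq> {..n}" by (auto simp: B_def)
    moreover have "inj_on idx (B n)" using idx by (rule inj_on_subset) (auto simp: B_def)
    ultimately show ?thesis by (meson finite_atMost inj_on_finite)
  qed
  have BG: "B n \<subseteq> carrier G" for n by (auto simp: B_def)
  obtain h where h: "\<And>n. h n \<in> carrier G"
    "\<And>n k x y. x \<in> B n \<Longrightarrow> y \<in> B k \<Longrightarrow> x \<otimes> h n = y \<otimes> h k \<Longrightarrow> n = k"
    by (rule disjoint_translates[of B, OF inf finB BG]) (rule that)
  \<comment> \<open>The first coordinate under \<open>prod_decode\<close> splits the naturals into
    infinitely many infinite classes, one for each \<open>i\<close>.\<close>
  define A where "A i = {x \<otimes> h n | x n. fst (prod_decode n) = i \<and> x \<in> B n}" for i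
  \<comment> \<open>As \<open>k\<close> runs through the group,
    \<open>prod_encode (i, idx k)\<close> runs injectively through class \<open>i\<close>.\<close>
  define w where "w i k = h (prod_encode (i, idx k))" for i k
  define M where "M i = orbit_mean G m (w i)" for i
  \<comment> \<open>Outside the finite set \<open>B (idx g)\<close>, the index of \<open>k\<close>
    exceeds that of \<open>g\<close>, and \<open>prod_encode\<close> is at least its second
    argument. So \<open>g\<close> lies in the block of that number, and disjointness of the
    translates leaves only class \<open>i\<close>.\<close>
  have mem: "indicator (A j) (g \<otimes> w i k) = (of_bool (i = j) :: real)"
    if g: "g \<in> carrier G" and k: "k \<in> carrier G - B (idx g)" for i j g k
  proof -
    let ?n = "prod_encode (i, idx k)"
    have "idx g \<le> ?n" using k le_prod_encode_2[of "idx k" i] by (auto simp: B_def)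
    then have gn: "g \<in> B ?n" using g by (simp add: B_def)
    have "g \<otimes> h ?n \<in> A j \<longleftrightarrow> i = j"
    proof
      assume "g \<otimes> h ?n \<in> A j"
      then obtain x n where "g \<otimes> h ?n = x \<otimes> h n" "fst (prod_decode n) = j" "x \<in> B n"
        by (auto simp: A_def)
      with h(2)[OF gn, of x n] show "i = j" by auto
    next
      assume "i = j"
      then show "g \<otimes> h ?n \<in> A j" using gn unfolding A_def by force
    qed
    then show ?thesis by (simp add: w_def indicator_def)
  qed
  show thesis
  proof (rule that)
    show "M i \<in> invariant_means G" for i
      unfolding M_def by (rule orbit_mean_invariant[OF m]) (auto simp: w_def h)
    show "A i \<subseteq> carrier G" for i
      using h(1) by (auto simp: A_def B_def)
    show "M i (indicator (A j)) = of_bool (i = j)" for i j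
    proof -
      \<comment> \<open>By \<open>mem\<close> the inner integrand is constant off a finite set, so
        the inner average is the same for every \<open>g\<close>.\<close>
      have "m (\<lambda>k. if k \<in> carrier G then indicator (A j) (g \<otimes> w i k) else 0) = of_bool (i = j)"
        if g: "g \<in> carrier G" for g
        using mem[OF g] by (intro mean_eventually_const[OF m inf finB])
      then have "M i (indicator (A j)) = m (\<lambda>g. if g \<in> carrier G then of_bool (i = j) else 0)"
        unfolding M_def orbit_mean_def by (intro arg_cong[of _ _ m]) auto
      then show ?thesis by (simp only: mean_const[OF m])
    qed
  qed
qed

section \<open>Transfer to uniformly finite homology\<close>

lemma countable_finitely_generated:
  assumes "group G" "finite S" "S \<subseteq> carrier G" "generate G S = carrier G"
  shows "countable (carrier G)"
proof (rule countable_subset)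
  let ?T = "S \<union> m_inv G ` S"
  show "carrier G \<subseteq> (\<lambda>w. foldr (\<otimes>\<^bsub>G\<^esub>) w \<one>\<^bsub>G\<^esub>) ` lists ?T"
    using ex_word[OF assms] by (auto simp: image_iff) (metis in_lists_conv_set subset_iff)
  show "countable ((\<lambda>w. foldr (\<otimes>\<^bsub>G\<^esub>) w \<one>\<^bsub>G\<^esub>) ` lists ?T)"
    using assms(2) by (intro countable_image countable_lists) (simp add: countable_finite)
qed


theorem theorem3p7:
  fixes G :: "('a, 'b) monoid_scheme" and S :: "'a set"
  assumes "group G"
    and "finite S" and "S \<subseteq> carrier G" and "generate G S = carrier G"
    and "infinite (carrier G)"
    and "amenable G"
  shows "\<not> vectorspace.fin_dim class_ring
            (quot_module (uf_homology G S 0) (mean_invisible G S))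
       \<and> \<not> vectorspace.fin_dim class_ring (uf_homology G S 0)"
proof -
  note gen = assms(1-4)
  interpret group G by (rule assms(1))
  let ?C = "uf_chains G S 0" and ?B = "uf_boundaries G S 0" and ?H = "uf_homology G S 0"
  obtain M A where M: "\<And>i::nat. M i \<in> invariant_means G" and A: "\<And>i. A i \<subseteq> carrier G"
    and MA: "\<And>i j. M i (indicator (A j)) = of_bool (i = j)"
    using separated_invariant_means[OF countable_finitely_generated[OF gen] assms(5,6)] by blast
  \<comment> \<open>The inverse cancels the inversion inside \<open>mean_chain\<close>; 0-chains
    live on one-element lists.\<close>
  define c where "c j = (indicator {[g] | g. g \<in> carrier G \<and> inv\<^bsub>G\<^esub> g \<in> A j} :: 'a list \<Rightarrow> real)" for j
  have c: "c j \<in> carrier ?C" for j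
    by (auto simp: uf_chains_0[OF gen] tuples0[OF gen] bounded_iff c_def indicator_def intro!: exI[of _ 1])
  have Mc: "mean_chain G (M i) (c j) = of_bool (i = j)" for i j
  proof -
    have "(\<lambda>g. if g \<in> carrier G then c j [inv\<^bsub>G\<^esub> g] else 0) = indicator (A j)"
      using A by (auto simp: c_def indicator_def fun_eq_iff)
    then show ?thesis by (simp add: mean_chain_def MA)
  qed
  have zero: "(\<lambda>x. 0) \<in> carrier ?C" by (simp add: uf_chains_0[OF gen])
  have lin: "linear_functional ?C (mean_chain G (M i))" for i
  proof -
    \<comment> \<open>\<open>mean_chain_linear\<close> treats \<open>a * c x + d x\<close> at once.
      With \<open>a = 1\<close> and both chains zero it says that the value equals its own double;
      scaling alone is then the case of zero \<open>d\<close>.\<close>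
    have "mean_chain G (M i) (\<lambda>x. 0) = 0"
      using mean_chain_linear[OF gen M zero zero, of i 1] by simp
    then show ?thesis
      using mean_chain_linear[OF gen M, of _ _ i 1] mean_chain_linear[OF gen M _ zero, of _ i]
      by (simp add: linear_functional_def)
  qed
  note subB = uf_boundaries_0_subspace[OF gen] and H = uf_homology_0[OF gen]
  have mB: "mean_chain G (M i) b = 0" if "b \<in> ?B" for b i
    using that mean_chain_boundary[OF gen _ M] by (auto simp: uf_boundaries_def)
  have linH: "linear_functional ?H (mean_class G (M i))" for i
    using quot_module_functional(1)[OF subB lin mB] by (simp add: mean_class_def[abs_def] H)
  define x where "x j = ?B +>\<^bsub>?C\<^esub> c j" for j
  have x: "x j \<in> carrier ?H" for j
    unfolding H carrier_quot_module x_def using c by blast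
  have Mx: "mean_class G (M i) (x j) = of_bool (i = j)" for i j
    unfolding x_def mean_class_coset[OF gen M c] by (rule Mc)
  note subI = mean_invisible_subspace[OF gen]
  have mI: "mean_class G (M i) X = 0" if "X \<in> mean_invisible G S" for X i
    using that M by (simp add: mean_invisible_def)
  \<comment> \<open>Mean-invisible classes are killed by every invariant mean, in particular by each
    \<open>M i\<close>, so the functionals descend a second time.\<close>
  note quot = quot_module_functional[OF subI linH mI]
  have "\<not> vectorspace.fin_dim class_ring (quot_module ?H (mean_invisible G S))"
  proof (rule not_fin_dim_biorthogonal[OF visible_quotient_vectorspace[OF gen] quot(1)])
    show "mean_invisible G S +>\<^bsub>?H\<^esub> x j \<in> carrier (quot_module ?H (mean_invisible G S))" for j
      unfolding carrier_quot_module using x by blast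
    show "the_elem (mean_class G (M i) ` (mean_invisible G S +>\<^bsub>?H\<^esub> x j)) = of_bool (i = j)" for i j
      using quot(2)[OF _ x] Mx by simp
  qed
  \<comment> \<open>The same functionals, taken before the second descent, already separate the
    classes \<open>x j\<close>.\<close>
  moreover have "\<not> vectorspace.fin_dim class_ring ?H"
    by (rule not_fin_dim_biorthogonal[OF uf_homology_0_vectorspace[OF gen] linH x Mx])
  ultimately show ?thesis by blast
qed

end
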